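(* Let $\mathcal{C}$ be a commutative ternary group, with $Q_0, R_0 \in \mathcal{C}$ as in its Identity and Inverses axioms. Let $\mathcal{G}$ be the collection of formal symbols $P \cdot Q^*$ with $P, Q \in \mathcal{C}$, modulo the equivalence relation $P \cdot Q^* \sim R \cdot S^*$ whenever $P \cdot Q^* \cdot R_0 = R \cdot S^* \cdot R_0$ in $\mathcal{C}$. Then $\mathcal{G}$ (with the operation and action described in the context) is an abelian group with a transitive left action on $\mathcal{C}$.
   Context: A set $\mathcal{C}$ is a commutative ternary group if there is a triple product $(P,Q,R) \mapsto P \cdot Q^* \cdot R$ (here $Q^*$ is only part of the notation) such that for all $P,Q,R,S,T \in \mathcal{C}$: (1) (Multiplication) $P \cdot Q^* \cdot R \in \mathcal{C}$; (2) (Commutativity) $P \cdot Q^* \cdot R = R \cdot Q^* \cdot P$; (3) (Associativity) $(P \cdot Q^* \cdot R) \cdot S^* \cdot T = P \cdot Q^* \cdot (R \cdot S^* \cdot T)$; and there exist $Q_0, R_0 \in \mathcal{C}$ such that (4) (Identity) $P \cdot Q_0^* \cdot R_0 = P$ for all $P \in \mathcal{C}$; (5) (Inverses) for every $P \in \mathcal{C}$ there is $R \in \mathcal{C}$ with $P \cdot Q_0^* \cdot R = R_0$. Operation and action: every symbol $P \cdot Q^*$ is equivalent to a symbol of the form $P' \cdot Q_0^*$, with $P' = P \cdot Q_0^* \cdot (R_0 \cdot Q^* \cdot R_0)$. On classes of symbols $g = P \cdot Q_0^*$ and $h = Q \cdot Q_0^*$ one sets $g \cdot h = (P \cdot Q_0^*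 \cdot Q) \cdot Q_0^*$, and $g = P \cdot Q_0^*$ acts on $Q \in \mathcal{C}$ by $g \cdot Q = P \cdot Q_0^* \cdot Q$. *)

theory Defs
  imports "HOL-Algebra.Group_Action"
begin

text \<open>The triple product is a ternary function: \<open>t P Q R\<close> stands for $P \cdot Q^* \cdot R$.\<close>

definition ternary_base_pair :: "'a set \<Rightarrow> ('a \<Rightarrow> 'a \<Rightarrow> 'a \<Rightarrow> 'a) \<Rightarrow> 'a \<Rightarrow> 'a \<Rightarrow> bool" where
  "ternary_base_pair C t Q0 R0 \<longleftrightarrow>
     Q0 \<in> C \<and> R0 \<in> C \<and>
     (\<forall>P\<in>C. t P Q0 R0 = P) \<and>
     (\<forall>P\<in>C. \<exists>R\<in>C. t P Q0 R = R0)"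

locale commutative_ternary_group =
  fixes C :: "'a set" and t :: "'a \<Rightarrow> 'a \<Rightarrow> 'a \<Rightarrow> 'a"
  assumes multiplication:
      "\<lbrakk>P \<in> C; Q \<in> C; R \<in> C\<rbrakk> \<Longrightarrow> t P Q R \<in> C"
    and commutativity:
      "\<lbrakk>P \<in> C; Q \<in> C; R \<in> C\<rbrakk> \<Longrightarrow> t P Q R = t R Q P"
    and associativity:
      "\<lbrakk>P \<in> C; Q \<in> C; R \<in> C; S \<in> C; T \<in> C\<rbrakk> \<Longrightarrow> t (t P Q R) S T = t P Q (t R S T)"
    and base_pair_exists:
      "\<exists>Q0 R0. ternary_base_pair C t Q0 R0"

text \<open>The formal symbol $P \cdot Q^*$ is the pair \<open>(P, Q)\<close>.\<close>

definition symbol_rel :: "'a set \<Rightarrow> ('a \<Rightarrow> 'a \<Rightarrow> 'a \<Rightarrow> 'a) \<Rightarrow> 'a \<Rightarrow> (('a \<times> 'a) \<times> ('a \<times> 'a)) set" where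
  "symbol_rel C t R0 =
     {((P, Q), (R, S)) | P Q R S.
        P \<in> C \<and> Q \<in> C \<and> R \<in> C \<and> S \<in> C \<and> t P Q R0 = t R S R0}"

definition symbol_class :: "'a set \<Rightarrow> ('a \<Rightarrow> 'a \<Rightarrow> 'a \<Rightarrow> 'a) \<Rightarrow> 'a \<Rightarrow> 'a \<Rightarrow> 'a \<Rightarrow> ('a \<times> 'a) set" where
  "symbol_class C t R0 P Q = symbol_rel C t R0 `` {(P, Q)}"

text \<open>
  The operation and the action are prescribed on representatives of the form
  $P \cdot Q_0^*$. The description operator makes no choice of representative, so it denotes
  the prescribed value only if such representatives exist and the value does not depend on them.
  The neutral element, which the record type requires, is the class of $R_0 \cdot Q_0^*$.
\<close>

definition symbol_group ::
    "'a set \<Rightarrow> ('a \<Rightarrow> 'a \<Rightarrow> 'a \<Rightarrow> 'a) \<Rightarrow> 'a \<Rightarrow> 'a \<Rightarrow> ('a \<times> 'a) set monoid" where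
  "symbol_group C t Q0 R0 =
     \<lparr>carrier = (C \<times> C) // symbol_rel C t R0,
      mult = (\<lambda>g h. THE k. \<exists>P\<in>C. \<exists>Q\<in>C.
                g = symbol_class C t R0 P Q0 \<and>
                h = symbol_class C t R0 Q Q0 \<and>
                k = symbol_class C t R0 (t P Q0 Q) Q0),
      one = symbol_class C t R0 R0 Q0\<rparr>"

text \<open>Restriction to \<open>C\<close> is needed because \<^const>\<open>BijGroup\<close> consists of extensional functions.\<close>

definition symbol_action ::
    "'a set \<Rightarrow> ('a \<Rightarrow> 'a \<Rightarrow> 'a \<Rightarrow> 'a) \<Rightarrow> 'a \<Rightarrow> 'a \<Rightarrow> ('a \<times> 'a) set \<Rightarrow> 'a \<Rightarrow> 'a" where
  "symbol_action C t Q0 R0 g =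
     (\<lambda>Q\<in>C. THE S. \<exists>P\<in>C. g = symbol_class C t R0 P Q0 \<and> S = t P Q0 Q)"

end

theory Submission
  imports Defs
begin

text \<open>
  Since $P \cdot Q_0^* \cdot R_0 = P$, every class has exactly one representative of the form
  $P \cdot Q_0^*$. Hence $P \mapsto [P \cdot Q_0^*]$ is a bijection from $\mathcal{C}$ onto the
  set of classes, which carries the product $P \cdot Q_0^* \cdot Q$ to the group operation. The
  latter is an abelian group law on $\mathcal{C}$ with neutral element $R_0$, and the action is the
  regular action of this group.
\<close>

text \<open>The ternary group only asserts that some base pair exists; the constructions depend on a
  chosen one, so an arbitrary pair is fixed.\<close>

locale based_ternary_group = commutative_ternary_group +
  fixes Q0 R0 :: 'a
  assumes base: "ternary_base_pair C t Q0 R0"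
begin

lemma Q0_closed [simp]: "Q0 \<in> C"
  and R0_closed [simp]: "R0 \<in> C"
  and identity [simp]: "P \<in> C \<Longrightarrow> t P Q0 R0 = P"
  and inverse_exists: "P \<in> C \<Longrightarrow> \<exists>R\<in>C. t P Q0 R = R0"
  using base by (auto simp: ternary_base_pair_def)

declare multiplication [simp]

lemma left_identity [simp]: "P \<in> C \<Longrightarrow> t R0 Q0 P = P"
  using commutativity[of R0 Q0 P] by simp

text \<open>The relation is the kernel of the map \<open>(P, Q)\<close> to \<open>t P Q R0\<close>
  on \<open>C \<times> C\<close>.\<close>

lemma equiv_symbol_rel: "equiv (C \<times> C) (symbol_rel C t R0)"
  by (rule equivI) (auto simp: symbol_rel_def refl_on_def sym_def trans_def)

lemma symbol_class_eq_iff: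
  assumes "P \<in> C" "Q \<in> C" "R \<in> C" "S \<in> C"
  shows "symbol_class C t R0 P Q = symbol_class C t R0 R S \<longleftrightarrow> t P Q R0 = t R S R0"
  unfolding symbol_class_def
  using assms by (subst eq_equiv_class_iff[OF equiv_symbol_rel]) (auto simp: symbol_rel_def)

lemma symbol_class_normal_form:
  assumes "P \<in> C" "Q \<in> C"
  shows "symbol_class C t R0 P Q = symbol_class C t R0 (t P Q0 (t R0 Q R0)) Q0"
proof -
  have "t P Q R0 = t (t P Q0 R0) Q R0"
    using assms by simp
  \<comment> \<open>\<open>identity\<close> would collapse \<open>t P Q0 R0\<close> back to
    \<open>P\<close> before \<open>associativity\<close> could apply, so it is switched off.\<close>
  also have "\<dots> = t P Q0 (t R0 Q R0)"
    using assms by (simp add: associativity del: identity)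
  finally show ?thesis
    using assms by (simp add: symbol_class_eq_iff)
qed

text \<open>With second entry \<open>Q0\<close>, \<open>identity\<close> collapses both sides of the
  criterion. This injectivity makes the definite descriptions in the product and the action well
  defined.\<close>

lemma symbol_class_base_eq_iff [simp]:
  assumes "P \<in> C" "R \<in> C"
  shows "symbol_class C t R0 P Q0 = symbol_class C t R0 R Q0 \<longleftrightarrow> P = R"
  using assms by (simp add: symbol_class_eq_iff)

abbreviation group_of_symbols where
  "group_of_symbols \<equiv> symbol_group C t Q0 R0"

lemma carrier_symbol_group:
  "carrier group_of_symbols = (\<lambda>P. symbol_class C t R0 P Q0) ` C"
proof -
  have "carrier group_of_symbols = {symbol_class C t R0 P Q | P Q. P \<in> C \<and> Q \<in> C}"
    by (auto simp: symbol_group_def quotient_def symbol_class_def)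
  also have "\<dots> = (\<lambda>P. symbol_class C t R0 P Q0) ` C"
  proof (intro equalityI subsetI)
    fix g assume "g \<in> {symbol_class C t R0 P Q | P Q. P \<in> C \<and> Q \<in> C}"
    then obtain P Q where "P \<in> C" "Q \<in> C" "g = symbol_class C t R0 P Q" by blast
    then show "g \<in> (\<lambda>P. symbol_class C t R0 P Q0) ` C"
      by (intro image_eqI[of _ _ "t P Q0 (t R0 Q R0)"]) (simp_all add: symbol_class_normal_form[of P Q])
  qed (use Q0_closed in blast)
  finally show ?thesis .
qed

lemma one_symbol_group: "\<one>\<^bsub>group_of_symbols\<^esub> = symbol_class C t R0 R0 Q0"
  by (simp add: symbol_group_def)

lemma mult_symbol_group:
  assumes "P \<in> C" "Q \<in> C"
  shows "symbol_class C t R0 P Q0 \<otimes>\<^bsub>group_of_symbols\<^esub> symbol_class C t R0 Q Q0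
    = symbol_class C t R0 (t P Q0 Q) Q0"
  unfolding symbol_group_def monoid.simps
  by (rule the_equality) (use assms in auto)

lemma symbol_action_apply:
  assumes "P \<in> C" "Q \<in> C"
  shows "symbol_action C t Q0 R0 (symbol_class C t R0 P Q0) Q = t P Q0 Q"
  unfolding symbol_action_def restrict_apply'[OF assms(2)]
  by (rule the_equality) (use assms in auto)

lemma comm_group_symbol_group: "comm_group group_of_symbols"
proof (rule comm_groupI; unfold carrier_symbol_group one_symbol_group)
  fix x assume "x \<in> (\<lambda>P. symbol_class C t R0 P Q0) ` C"
  then obtain P where P: "P \<in> C" "x = symbol_class C t R0 P Q0" by blast
  obtain R where R: "R \<in> C" "t P Q0 R = R0"
    using inverse_exists P(1) by blast
  show "\<exists>y\<in>(\<lambda>P. symbol_class C t R0 P Q0) ` C.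
      y \<otimes>\<^bsub>group_of_symbols\<^esub> x = symbol_class C t R0 R0 Q0"
    \<comment> \<open>\<open>inverse_exists\<close> supplies a right inverse, while a left one is
      demanded; commutativity exchanges them.\<close>
    using P R commutativity[of R Q0 P] by (auto simp: mult_symbol_group)
next
  fix x y assume "x \<in> (\<lambda>P. symbol_class C t R0 P Q0) ` C" "y \<in> (\<lambda>P. symbol_class C t R0 P Q0) ` C"
  then show "x \<otimes>\<^bsub>group_of_symbols\<^esub> y = y \<otimes>\<^bsub>group_of_symbols\<^esub> x"
    using commutativity[OF _ Q0_closed] by (auto simp: mult_symbol_group simp del: symbol_class_base_eq_iff)
\<comment> \<open>Closure, associativity and the left unit carry over from the operation
  \<open>t _ Q0 _\<close> on \<open>C\<close>.\<close>
qed (auto simp: mult_symbol_group associativity)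

text \<open>Translation by an inverse \<open>R\<close> of \<open>P\<close> undoes translation by
  \<open>P\<close>: reassociating brings \<open>P\<close> and \<open>R\<close> together, and they
  cancel to \<open>R0\<close>.\<close>

lemma left_translation_bij:
  assumes "P \<in> C"
  shows "bij_betw (t P Q0) C C"
proof -
  obtain R where R: "R \<in> C" "t P Q0 R = R0"
    using inverse_exists assms by blast
  then have "t R Q0 P = R0"
    using assms commutativity[of R Q0 P] by simp
  then have "t P Q0 (t R Q0 S) = S" "t R Q0 (t P Q0 S) = S" if "S \<in> C" for S
    using assms R that by (simp_all flip: associativity)
  with assms R show ?thesis
    by (intro bij_betw_byWitness[of _ "t R Q0"]) auto
qed

lemma symbol_action_in_Bij:
  assumes "P \<in> C"
  shows "symbol_action C t Q0 R0 (symbol_class C t R0 P Q0) \<in> Bij C"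
proof -
  let ?f = "symbol_action C t Q0 R0 (symbol_class C t R0 P Q0)"
  have "?f \<in> extensional C"
    by (simp add: symbol_action_def)
  moreover have "bij_betw ?f C C"
    using left_translation_bij[OF assms] symbol_action_apply[OF assms]
    by (simp cong: bij_betw_cong)
  ultimately show ?thesis
    by (simp add: Bij_def)
qed

lemma transitive_symbol_action:
  "transitive_action group_of_symbols C (symbol_action C t Q0 R0)"
proof -
  interpret G: comm_group group_of_symbols
    by (rule comm_group_symbol_group)
  \<comment> \<open>Compatibility with products is associativity of \<open>t\<close>. It is stated
    with \<open>compose C\<close> because that is the multiplication of
    \<open>BijGroup C\<close>.\<close>
  have action_mult: "symbol_action C t Q0 R0 (symbol_class C t R0 (t P Q0 Q) Q0)
      = compose C (symbol_action C t Q0 R0 (symbol_class C t R0 P Q0))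
          (symbol_action C t Q0 R0 (symbol_class C t R0 Q Q0))"
    if "P \<in> C" "Q \<in> C" for P Q
  proof (rule extensionalityI[of _ C])
    show "symbol_action C t Q0 R0 (symbol_class C t R0 (t P Q0 Q) Q0) \<in> extensional C"
      by (simp add: symbol_action_def)
  qed (use that in \<open>auto simp: compose_def symbol_action_apply associativity\<close>)
  have "symbol_action C t Q0 R0 \<in> hom group_of_symbols (BijGroup C)"
    by (rule homI)
      (auto simp: carrier_symbol_group BijGroup_def mult_symbol_group action_mult
        symbol_action_in_Bij)
  then have action: "group_action group_of_symbols C (symbol_action C t Q0 R0)"
    by (simp add: group_action_def group_hom_def group_hom_axioms_def G.is_group group_BijGroup)
  have "\<exists>g\<in>carrier group_of_symbols. symbol_action C t Q0 R0 g x = y"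
    if "x \<in> C" "y \<in> C" for x y
  proof -
    obtain R where R: "R \<in> C" "t x Q0 R = R0"
      using inverse_exists \<open>x \<in> C\<close> by blast
    \<comment> \<open>Since \<open>R\<close> is the inverse of \<open>x\<close>, the element
      \<open>t y Q0 R\<close> is the quotient of \<open>y\<close> by \<open>x\<close>, whose class
      moves \<open>x\<close> to \<open>y\<close>.\<close>
    then have "t (t y Q0 R) Q0 x = y"
      using that commutativity[of R Q0 x] by (simp add: associativity)
    with that R show ?thesis
      by (auto simp: carrier_symbol_group symbol_action_apply intro!: bexI[of _ "t y Q0 R"])
  qed
  with action show ?thesis
    by (simp add: transitive_action_def transitive_action_axioms_def)
qed

end

text \<open>The third and fourth conjuncts certify that the descriptions defining product and action
  denote the prescribed values; the second shows that every class has a representative to which they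
  apply.\<close>

theorem proposition3p3:
  fixes C :: "'a set" and t :: "'a \<Rightarrow> 'a \<Rightarrow> 'a \<Rightarrow> 'a" and Q0 R0 :: 'a
  assumes "commutative_ternary_group C t"
    and "ternary_base_pair C t Q0 R0"
  shows
    "equiv (C \<times> C) (symbol_rel C t R0) \<and>
     (\<forall>P\<in>C. \<forall>Q\<in>C. symbol_class C t R0 P Q = symbol_class C t R0 (t P Q0 (t R0 Q R0)) Q0) \<and>
     (\<forall>P\<in>C. \<forall>Q\<in>C.
        symbol_class C t R0 P Q0 \<otimes>\<^bsub>symbol_group C t Q0 R0\<^esub> symbol_class C t R0 Q Q0
          = symbol_class C t R0 (t P Q0 Q) Q0) \<and>
     (\<forall>P\<in>C. \<forall>Q\<in>C. symbol_action C t Q0 R0 (symbol_class C t R0 P Q0) Q = t P Q0 Q) \<and>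
     comm_group (symbol_group C t Q0 R0) \<and>
     transitive_action (symbol_group C t Q0 R0) C (symbol_action C t Q0 R0)"
proof -
  interpret based_ternary_group C t Q0 R0
    using assms by (simp add: based_ternary_group_def based_ternary_group_axioms_def)
  show ?thesis
    using equiv_symbol_rel symbol_class_normal_form mult_symbol_group symbol_action_apply
      comm_group_symbol_group transitive_symbol_action
    by blast
qed

end
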